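(* Let $Y$ be a Bernoulli random variable with probability of success $p$, let $Y_1,Y_2,\dots$ be i.i.d. copies of $Y$, and $S_k=Y_1+\cdots+Y_k$ ($S_0=0$), $k\ge 0$. For all integers $n\ge 0$, $$E\big[\langle S_{k}\rangle_{n,\lambda}\big]=\sum_{j=0}^{n}\binom{k}{j}p^{j}j!\,H_{\lambda}(n,j).$$
   Context: Fix a nonzero real $\lambda$. Put $\langle x\rangle_{0,\lambda}=1$, $\langle x\rangle_{n,\lambda}=x(x+\lambda)\cdots(x+(n-1)\lambda)$ for $n\ge1$. The heterogeneous Stirling numbers of the second kind $H_\lambda(n,j)$ are defined by $\frac{1}{j!}((1-\lambda t)^{-1/\lambda}-1)^{j}=\sum_{n\ge j}H_{\lambda}(n,j)\frac{t^{n}}{n!}$ (so $H_\lambda(0,0)=1$ and $H_\lambda(n,0)=0$ for $n\ge1$). *)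

theory Defs
  imports "HOL-Probability.Probability" "HOL-Computational_Algebra.Formal_Power_Series"
begin

text \<open>\<open>gen_rising \<lambda> n x\<close> is \<open>\<langle>x\<rangle>\<^bsub>n,\<lambda>\<^esub> = x (x + \<lambda>) \<cdots> (x + (n - 1) \<lambda>)\<close>.\<close>
definition gen_rising :: "real \<Rightarrow> nat \<Rightarrow> real \<Rightarrow> real" where
  "gen_rising l n x = (\<Prod>i<n. x + real i * l)"

text \<open>The power series of \<open>(1 - \<lambda> t) powr (-1 / \<lambda>)\<close> at \<open>t = 0\<close>, obtained by substituting
  \<open>-\<lambda> t\<close> into the binomial series; see \<open>has_fps_expansion_het_exp\<close> below.\<close>
definition het_exp :: "real \<Rightarrow> real fps" where
  "het_exp l = fps_compose (fps_binomial (-1 / l)) (fps_const (-l) * fps_X)"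

definition het_stirling :: "real \<Rightarrow> nat \<Rightarrow> nat \<Rightarrow> real" where
  "het_stirling l n j = fact n * fps_nth (fps_const (1 / fact j) * (het_exp l - 1) ^ j) n"

text \<open>The library's Bernoulli distribution lives on \<^typ>\<open>bool\<close>; it is pushed forward to the
  reals along \<open>False \<mapsto> 0\<close>, \<open>True \<mapsto> 1\<close>.\<close>
definition bernoulli_rv :: "'a measure \<Rightarrow> real \<Rightarrow> ('a \<Rightarrow> real) \<Rightarrow> bool" where
  "bernoulli_rv M p X \<longleftrightarrow> X \<in> borel_measurable M \<and>
     distr M borel X = distr (measure_pmf (bernoulli_pmf p)) borel of_bool"

definition iid_copies :: "'a measure \<Rightarrow> ('a \<Rightarrow> real) \<Rightarrow> nat set \<Rightarrow> (nat \<Rightarrow> 'a \<Rightarrow> real) \<Rightarrow> bool" where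
  "iid_copies M Y I X \<longleftrightarrow> prob_space.indep_vars M (\<lambda>_. borel) X I \<and>
     (\<forall>i\<in>I. distr M borel (X i) = distr M borel Y)"

lemma fps_nth_het_exp: "fps_nth (het_exp l) n = ((-1 / l) gchoose n) * (-l) ^ n"
  by (simp only: het_exp_def fps_compose_linear) simp

lemma has_fps_expansion_het_exp:
  assumes "l \<noteq> 0"
  shows "(\<lambda>t. (1 - l * t) powr (-1 / l)) has_fps_expansion het_exp l"
proof -
  have s: "(\<lambda>n. fps_nth (het_exp l) n * t ^ n) sums ((1 - l * t) powr (-1 / l))"
    if "\<bar>t\<bar> < 1 / \<bar>l\<bar>" for t
  proof -
    have "\<bar>- l * t\<bar> < 1"
      using that assms by (simp add: abs_mult field_simps)
    from gen_binomial_real[OF this, of "-1 / l"] show ?thesis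
      by (simp add: fps_nth_het_exp power_mult_distrib[symmetric] mult.assoc)
  qed
  have "ereal (norm (1 / (2 * \<bar>l\<bar>))) \<le> conv_radius (fps_nth (het_exp l))"
    using s[of "1 / (2 * \<bar>l\<bar>)"] assms
    by (intro conv_radius_geI) (auto simp: sums_iff field_simps)
  moreover have "0 < ereal (norm (1 / (2 * \<bar>l\<bar>)))"
    using assms by simp
  ultimately have "fps_conv_radius (het_exp l) > 0"
    unfolding fps_conv_radius_def by (rule order.strict_trans2[rotated])
  moreover have "eventually (\<lambda>t::real. \<bar>t\<bar> < 1 / \<bar>l\<bar>) (nhds 0)"
    using assms eventually_nhds_in_open[of "ball 0 (1 / \<bar>l\<bar>)" "0::real"] by simp
  then have "eventually (\<lambda>t. eval_fps (het_exp l) t = (1 - l * t) powr (-1 / l)) (nhds 0)"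
    by eventually_elim (use s in \<open>simp add: eval_fps_def sums_iff\<close>)
  ultimately show ?thesis
    by (simp add: has_fps_expansion_def)
qed

lemma het_stirling_egf:
  assumes "l \<noteq> 0"
  shows "(\<lambda>t. 1 / fact j * ((1 - l * t) powr (-1 / l) - 1) ^ j)
           has_fps_expansion Abs_fps (\<lambda>n. het_stirling l n j / fact n)"
proof -
  have "(\<lambda>t. \<Prod>i<j. (1 - l * t) powr (-1 / l) - 1) has_fps_expansion (\<Prod>i<j. het_exp l - 1)"
    using has_fps_expansion_het_exp[OF assms] by (intro fps_expansion_intros)
  then have "(\<lambda>t. 1 / fact j * ((1 - l * t) powr (-1 / l) - 1) ^ j)
      has_fps_expansion fps_const (1 / fact j) * (het_exp l - 1) ^ j"
    by (intro has_fps_expansion_cmult_left) (simp only: prod_constant card_lessThan)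
  also have "fps_const (1 / fact j) * (het_exp l - 1) ^ j = Abs_fps (\<lambda>n. het_stirling l n j / fact n)"
    by (rule fps_ext) (simp add: het_stirling_def)
  finally show ?thesis .
qed

lemma het_stirling_eq_0:
  assumes "n < j"
  shows "het_stirling l n j = 0"
proof -
  have "fps_nth (het_exp l - 1) 0 = 0"
    by (simp add: fps_nth_het_exp)
  then show ?thesis
    using assms by (simp add: het_stirling_def startsby_zero_power_prefix)
qed

end

theory Submission
  imports Defs
begin

text \<open>Writing \<open>e\<close> for the series of \<open>(1 - \<lambda> t) powr (-1 / \<lambda>)\<close>, the coefficients of \<open>e ^ m\<close> are
  \<open>\<langle>m\<rangle>\<^bsub>n,\<lambda>\<^esub> / n!\<close>. Expanding \<open>e ^ m = ((e - 1) + 1) ^ m\<close> binomially expresses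
  \<open>\<langle>m\<rangle>\<^bsub>n,\<lambda>\<^esub>\<close> through the binomial coefficients \<open>m choose j\<close>. For \<open>m = S\<^sub>k\<close> such a coefficient
  is almost surely the sum of \<open>\<Prod>i\<in>A. Y\<^sub>i\<close> over the \<open>j\<close>-subsets \<open>A\<close> of \<open>{1..k}\<close>, each of which
  has expectation \<open>p ^ j\<close> by independence.\<close>

lemma het_exp_power:
  "het_exp l ^ m = fps_compose (fps_binomial (- real m / l)) (fps_const (- l) * fps_X)"
proof -
  have "fps_binomial (-1 / l) ^ m = fps_binomial (- real m / l)"
    by (simp add: fps_binomial_power)
  then show ?thesis
    by (simp add: het_exp_def fps_compose_power)
qed

text \<open>Exponents of binomial series add under multiplication, so the m-th power is the series
  with exponent \<open>- m / l\<close>, evaluated at \<open>- l * t\<close>. Its n-th coefficient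
  times n! is a falling product of n factors, and handing each of them one of the n factors
  \<open>- l\<close> turns \<open>- m / l - i\<close> into \<open>m + i * l\<close>.\<close>

lemma gen_rising_eq_fps_nth_het_exp_power:
  assumes "l \<noteq> 0"
  shows "gen_rising l n (real m) = fact n * fps_nth (het_exp l ^ m) n"
proof -
  have "fact n * fps_nth (het_exp l ^ m) n = (\<Prod>i<n. - real m / l - real i) * (- l) ^ n"
    by (simp only: het_exp_power fps_compose_linear)
      (simp add: gbinomial_prod_rev atLeast0LessThan)
  also have "\<dots> = (\<Prod>i<n. (- real m / l - real i) * (- l))"
    by (simp only: prod.distrib prod_constant card_lessThan)
  also have "\<dots> = gen_rising l n (real m)"
    unfolding gen_rising_def using assms by (intro prod.cong) (auto simp: field_simps)
  finally show ?thesis by simp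
qed

lemma gen_rising_of_nat_eq_sum_het_stirling:
  assumes "l \<noteq> 0"
  shows "gen_rising l n (real m) =
    (\<Sum>j=0..n. real (m choose j) * (fact j * het_stirling l n j))"
proof -
  let ?f = "\<lambda>j. real (m choose j) * (fact j * het_stirling l n j)"
  have "het_exp l ^ m = (\<Sum>j\<le>m. of_nat (m choose j) * (het_exp l - 1) ^ j)"
    using binomial_ring[of "het_exp l - 1" 1 m] by simp
  then have "gen_rising l n (real m) =
      (\<Sum>j\<le>m. fact n * fps_nth (of_nat (m choose j) * (het_exp l - 1) ^ j) n)"
    by (simp only: gen_rising_eq_fps_nth_het_exp_power[OF assms] fps_sum_nth sum_distrib_left)
  also have "\<dots> = sum ?f {..m}"
    by (intro sum.cong) (simp_all add: het_stirling_def fps_of_nat[symmetric])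
  \<comment> \<open>Passing through a common larger range avoids comparing m with n: the terms with
    j > m vanish because \<open>m choose j\<close> is 0, those with j > n because
    \<open>(het_exp l - 1) ^ j\<close> has no coefficient below degree j.\<close>
  also have "\<dots> = sum ?f {..max m n}"
    by (intro sum.mono_neutral_left) auto
  also have "\<dots> = sum ?f {0..n}"
    by (intro sum.mono_neutral_right) (auto simp: het_stirling_eq_0)
  finally show ?thesis .
qed

text \<open>For 0/1 values the product over A is the indicator that A lies inside the set where x is
  1, so the sum counts the j-subsets of that set. This trades a binomial coefficient for a
  multilinear polynomial, to which independence applies.\<close>

lemma sum_prod_subsets_eq_choose:
  fixes x :: "'i \<Rightarrow> real"
  assumes "finite I" and "\<And>i. i \<in> I \<Longrightarrow> x i = 0 \<or> x i = 1"
  shows "(\<Sum>A | A \<subseteq> I \<and> card A = j. \<Prod>i\<in>A. x i) = real (card {i\<in>I. x i = 1} choose j)"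
proof -
  let ?J = "{i\<in>I. x i = 1}"
  have "(\<Sum>A | A \<subseteq> I \<and> card A = j. \<Prod>i\<in>A. x i) = (\<Sum>A | A \<subseteq> ?J \<and> card A = j. \<Prod>i\<in>A. x i)"
  proof (intro sum.mono_neutral_right ballI)
    fix A assume A: "A \<in> {A. A \<subseteq> I \<and> card A = j} - {A. A \<subseteq> ?J \<and> card A = j}"
    then obtain i where "i \<in> A" "x i = 0" using assms(2) by blast
    moreover have "finite A" using A assms(1) by (auto intro: finite_subset)
    ultimately show "(\<Prod>i\<in>A. x i) = 0" by auto
  qed (use assms(1) in auto)
  also have "\<dots> = (\<Sum>A | A \<subseteq> ?J \<and> card A = j. 1)"
    by (intro sum.cong prod.neutral) auto
  also have "\<dots> = real (card ?J choose j)"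
    using assms(1) by (simp add: n_subsets)
  finally show ?thesis .
qed

context prob_space
begin

text \<open>The hypothesis concerns only the law of X, so other values are excluded merely up to a
  null set. The property is transported to the law, where it is clear from the range of
  \<open>of_bool\<close>, and back.\<close>

lemma AE_bernoulli_distr:
  assumes [measurable]: "X \<in> borel_measurable M"
    and D: "distr M borel X = distr (measure_pmf (bernoulli_pmf p)) borel of_bool"
  shows "AE \<omega> in M. X \<omega> = (0::real) \<or> X \<omega> = 1"
proof -
  have "AE x in distr M borel X. x = 0 \<or> x = 1"
    unfolding D by (subst AE_distr_iff) auto
  then show ?thesis
    by (subst (asm) AE_distr_iff) auto
qed

lemma integrable_bernoulli_distr:
  assumes [measurable]: "X \<in> borel_measurable M"
    and D: "distr M borel X = distr (measure_pmf (bernoulli_pmf p)) borel of_bool"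
  shows "integrable M (X :: 'a \<Rightarrow> real)"
  by (rule integrable_const_bound[where B = 1])
    (use AE_bernoulli_distr[OF assms] in \<open>auto elim: eventually_mono\<close>)

lemma expectation_bernoulli_distr:
  assumes [measurable]: "X \<in> borel_measurable M"
    and D: "distr M borel X = distr (measure_pmf (bernoulli_pmf p)) borel of_bool"
    and p: "0 \<le> p" "p \<le> 1"
  shows "expectation X = (p :: real)"
proof -
  have "expectation X = integral\<^sup>L (distr M borel X) (\<lambda>x. x)"
    by (subst integral_distr) auto
  also have "\<dots> = measure_pmf.expectation (bernoulli_pmf p) of_bool"
    unfolding D by (subst integral_distr) auto
  also have "\<dots> = p"
    using p by simp
  finally show ?thesis .
qed

end

theorem theorem2p20:
  fixes M :: "'a measure" and l p :: real
    and Y :: "'a \<Rightarrow> real" and X :: "nat \<Rightarrow> 'a \<Rightarrow> real" and k n :: nat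
  assumes "l \<noteq> 0"
    and "prob_space M"
    and "0 \<le> p" and "p \<le> 1"
    and "bernoulli_rv M p Y"
    and "iid_copies M Y {1..} X"
  shows "prob_space.expectation M (\<lambda>\<omega>. gen_rising l n (\<Sum>i=1..k. X i \<omega>)) =
    (\<Sum>j=0..n. real (k choose j) * p ^ j * fact j * het_stirling l n j)"
proof -
  interpret prob_space M by fact
  have indep: "indep_vars (\<lambda>_. borel) X {1..}"
    using assms(6) by (simp add: iid_copies_def)
  have meas [measurable]: "X i \<in> borel_measurable M" if "i \<in> {1..}" for i
    using indep that unfolding indep_vars_def by blast
  have D: "distr M borel (X i) = distr (measure_pmf (bernoulli_pmf p)) borel of_bool"
    if "i \<in> {1..}" for i
    using assms(5,6) that by (simp add: iid_copies_def bernoulli_rv_def)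
  let ?S = "\<lambda>j. {A. A \<subseteq> {1..k} \<and> card A = j}"
  let ?c = "\<lambda>j. fact j * het_stirling l n j"
  have indepA: "indep_vars (\<lambda>_. borel) X A" if "A \<in> ?S j" for A j
    by (rule indep_vars_subset[OF indep]) (use that in auto)
  have finA: "finite A" if "A \<in> ?S j" for A j
    using that by (auto intro: finite_subset)
  have intX: "integrable M (X i)" if "A \<in> ?S j" "i \<in> A" for A i j
    by (rule integrable_bernoulli_distr[OF meas D]) (use that in auto)
  have intA: "integrable M (\<lambda>\<omega>. \<Prod>i\<in>A. X i \<omega>)" if "A \<in> ?S j" for A j
    by (rule indep_vars_integrable[OF finA indepA intX]) (use that in auto)
  \<comment> \<open>The case j = 0 is included: A is then empty and both sides are 1.\<close>
  have expA: "expectation (\<lambda>\<omega>. \<Prod>i\<in>A. X i \<omega>) = p ^ j" if A: "A \<in> ?S j" for A j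
  proof -
    have "expectation (\<lambda>\<omega>. \<Prod>i\<in>A. X i \<omega>) = (\<Prod>i\<in>A. expectation (X i))"
      by (rule indep_vars_lebesgue_integral[OF finA indepA intX]) (use A in auto)
    also have "\<dots> = (\<Prod>i\<in>A. p)"
      by (intro prod.cong refl expectation_bernoulli_distr meas D assms(3,4)) (use A in auto)
    finally show ?thesis using A by simp
  qed
  have "AE \<omega> in M. \<forall>i\<in>{1..k}. X i \<omega> = 0 \<or> X i \<omega> = 1"
    by (intro AE_finite_allI AE_bernoulli_distr[OF meas D]) auto
  then have "AE \<omega> in M. gen_rising l n (\<Sum>i=1..k. X i \<omega>) =
      (\<Sum>j=0..n. (\<Sum>A\<in>?S j. \<Prod>i\<in>A. X i \<omega>) * ?c j)"
  proof eventually_elim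
    fix \<omega> assume x: "\<forall>i\<in>{1..k}. X i \<omega> = 0 \<or> X i \<omega> = 1"
    let ?m = "card {i\<in>{1..k}. X i \<omega> = 1}"
    \<comment> \<open>On this event the sum is the number of successes, a natural number, as the
      expansion of \<open>gen_rising\<close> requires.\<close>
    have "(\<Sum>i=1..k. X i \<omega>) = (\<Sum>i=1..k. if X i \<omega> = 1 then 1 else 0)"
      using x by (intro sum.cong) auto
    also have "\<dots> = real ?m"
      by (simp add: sum.If_cases Int_def)
    finally have m: "(\<Sum>i=1..k. X i \<omega>) = real ?m" .
    have "(\<Sum>A\<in>?S j. \<Prod>i\<in>A. X i \<omega>) = real (?m choose j)" for j
      by (rule sum_prod_subsets_eq_choose) (use x in auto)
    then show "gen_rising l n (\<Sum>i=1..k. X i \<omega>) =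
        (\<Sum>j=0..n. (\<Sum>A\<in>?S j. \<Prod>i\<in>A. X i \<omega>) * ?c j)"
      by (simp only: m gen_rising_of_nat_eq_sum_het_stirling[OF assms(1)])
  qed
  \<comment> \<open>Since the two integrands agree only almost everywhere, equality of the integrals
    also calls for the measurability of both.\<close>
  then have "expectation (\<lambda>\<omega>. gen_rising l n (\<Sum>i=1..k. X i \<omega>)) =
      expectation (\<lambda>\<omega>. \<Sum>j=0..n. (\<Sum>A\<in>?S j. \<Prod>i\<in>A. X i \<omega>) * ?c j)"
    by (intro integral_cong_AE) (auto simp: gen_rising_def intro!: borel_measurable_sum
        borel_measurable_prod borel_measurable_times borel_measurable_add meas)
  also have "\<dots> = (\<Sum>j=0..n. (\<Sum>A\<in>?S j. expectation (\<lambda>\<omega>. \<Prod>i\<in>A. X i \<omega>)) * ?c j)"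
  proof (subst Bochner_Integration.integral_sum)
    show "integrable M (\<lambda>\<omega>. (\<Sum>A\<in>?S j. \<Prod>i\<in>A. X i \<omega>) * ?c j)" for j
      by (intro integrable_mult_left Bochner_Integration.integrable_sum intA)
    have "expectation (\<lambda>\<omega>. \<Sum>A\<in>?S j. \<Prod>i\<in>A. X i \<omega>) =
        (\<Sum>A\<in>?S j. expectation (\<lambda>\<omega>. \<Prod>i\<in>A. X i \<omega>))" for j
      by (intro Bochner_Integration.integral_sum intA)
    then show "(\<Sum>j=0..n. expectation (\<lambda>\<omega>. (\<Sum>A\<in>?S j. \<Prod>i\<in>A. X i \<omega>) * ?c j)) =
        (\<Sum>j=0..n. (\<Sum>A\<in>?S j. expectation (\<lambda>\<omega>. \<Prod>i\<in>A. X i \<omega>)) * ?c j)"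
      by (simp only: integral_mult_left_zero)
  qed
  also have "\<dots> = (\<Sum>j=0..n. (\<Sum>A\<in>?S j. p ^ j) * ?c j)"
    by (intro sum.cong refl arg_cong2[where f = "(*)"] expA)
  also have "\<dots> = (\<Sum>j=0..n. real (k choose j) * p ^ j * fact j * het_stirling l n j)"
    by (simp add: n_subsets mult.assoc)
  finally show ?thesis .
qed

end
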